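(* The calculus PC$\pm$ is sound with respect to $\vDash_{PC\pm}$: every formula of $\mathcal{L}_{PC\pm}$ derivable in PC$\pm$ is true at every world of every conditional neighbourhood model under $\vDash_{PC\pm}$.
   Context: Fix a set $P$ of proposition letters and a finite set $Ag$ of agents. The language $\mathcal{L}_{PC\pm}$ is $\phi::=\top\mid p\mid\neg\phi\mid(\phi\wedge\phi)\mid B_a(\phi,\phi)\mid[\pm\phi]\phi$ ($p\in P$, $a\in Ag$); $\bot,\vee,\to,\leftrightarrow$ as usual, $K_a\phi:=\neg B_a(\neg\phi,\top)$, $\check K_a\phi:=\neg K_a\neg\phi$. A conditional neighbourhood model is $\mathfrak{M}=(W,N,V)$: $W$ non-empty, $V:P\to\mathcal{P}(W)$, and $N$ assigns to each $a\in Ag$, $w\in W$, $X\subseteq W$ a set $N_a^w(X)\subseteq\mathcal{P}(W)$ such that, writing $[w]_a=\{v\mid\forall X\subseteq W,\ N_a^w(X)=N_a^v(X)\}$ (the class of $w$ under the induced equivalence $\sim_a$): (c) each $Y\in N_a^w(X)$ has $Y\subseteq X\cap[w]_a$; (ec) if $X\cap[w]_a=Y\cap[w]_a$ then $N_a^w(X)=N_a^w(Y)$; (d) for $Y\in N_a^w(X)$, $(X\cap[w]_a)\setminus Y\notin N_a^w(X)$; (sc) for $Y,Z\subseteq X\cap[w]_a$, if $(X\cap[w]_a)\setminus Y\notin N_a^w(X)$ and $Y\subsetneq Z$ then $Z\in N_a^w(X)$. Semantics $\vDash_{PC\pm}$: $\top$ always true; $p$ iff $w\in V(p)$; Booleans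 as usual; $\mathfrak{M},w\vDash B_a(\phi,\psi)$ iff some $Y\in N_a^w(\llbracket\phi\rrbracket_{\mathfrak{M}})$ has $Y\subseteq\llbracket\psi\rrbracket_{\mathfrak{M}}$ (with $\llbracket\phi\rrbracket_{\mathfrak{M}}=\{v\mid\mathfrak{M},v\vDash\phi\}$); $\mathfrak{M},w\vDash[\pm\phi]\psi$ iff $\mathfrak{M}^{\pm\phi},w\vDash\psi$. The update $\mathfrak{M}^{\pm\phi}=(W,{}^{\pm\phi}N,V)$: let $w\sim_a^{\pm\phi}v$ iff $w\sim_a v$ and ($\mathfrak{M},w\vDash\phi$ iff $\mathfrak{M},v\vDash\phi$), with classes $[w]_a^{\pm\phi}$, and put ${}^{\pm\phi}N_a^w(X)=N_a^w(X\cap[w]_a^{\pm\phi})$. The calculus PC$\pm$ consists of the CN calculus over $\mathcal{L}_{PC\pm}$ — axioms (Taut) propositional tautologies; (Dist-K) $K_a(\phi\to\psi)\to K_a\phi\to K_a\psi$; (T) $K_a\phi\to\phi$; (5B) $B_a(\phi,\psi)\to K_aB_a(\phi,\psi)$; (4B) $\neg B_a(\phi,\psi)\to K_a\neg B_a(\phi,\psi)$; (D) $B_a(\phi,\psi)\to\neg B_a(\phi,\neg\psi)$; (EC) $K_a(\phi\leftrightarrow\psi)\to B_a(\phi,\chi)\to B_a(\psi,\chi)$; (M) $K_a(\phi\to\psi)\to B_a(\chi,\phi)\to B_a(\chi,\psi)$; (C) $B_a(\phi,\psi)\to B_a(\phi,\phi\wedge\psi)$; (SC) $\neg B_a(\chi,\neg\phi)\wedge\check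 K_a(\chi\wedge\neg\phi\wedge\psi)\to B_a(\chi,\phi\vee\psi)$; rules Modus Ponens and from $\phi$ infer $K_a\phi$ — plus the reduction axioms $[\pm\phi]p\leftrightarrow p$, $[\pm\phi]\neg\psi\leftrightarrow\neg[\pm\phi]\psi$, $[\pm\phi](\psi\wedge\chi)\leftrightarrow([\pm\phi]\psi\wedge[\pm\phi]\chi)$, and $[\pm\phi]B_a(\psi,\chi)\leftrightarrow(\phi\to B_a(\phi\wedge[\pm\phi]\psi,[\pm\phi]\chi))\wedge(\neg\phi\to B_a(\neg\phi\wedge[\pm\phi]\psi,[\pm\phi]\chi))$. *)

theory Defs
  imports Main
begin

datatype ('p, 'a) fm =
    Tru  ("\<^bold>\<top>")
  | Pro 'p
  | Neg "('p, 'a) fm"  ("\<^bold>\<not> _" [70] 70)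
  | Con "('p, 'a) fm" "('p, 'a) fm"  (infixr "\<^bold>\<and>" 65)
  | Bel 'a "('p, 'a) fm" "('p, 'a) fm"
  | Upd "('p, 'a) fm" "('p, 'a) fm"  ("[\<plusminus> _] _" [0, 70] 70)

abbreviation Dis  (infixr "\<^bold>\<or>" 60)
  where "\<phi> \<^bold>\<or> \<psi> \<equiv> \<^bold>\<not> (\<^bold>\<not> \<phi> \<^bold>\<and> \<^bold>\<not> \<psi>)"

abbreviation Imp  (infixr "\<^bold>\<longrightarrow>" 55)
  where "\<phi> \<^bold>\<longrightarrow> \<psi> \<equiv> \<^bold>\<not> (\<phi> \<^bold>\<and> \<^bold>\<not> \<psi>)"

abbreviation Iff  (infixr "\<^bold>\<longleftrightarrow>" 50)
  where "\<phi> \<^bold>\<longleftrightarrow> \<psi> \<equiv> (\<phi> \<^bold>\<longrightarrow> \<psi>) \<^bold>\<and> (\<psi> \<^bold>\<longrightarrow> \<phi>)"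

abbreviation Know :: "'a \<Rightarrow> ('p, 'a) fm \<Rightarrow> ('p, 'a) fm"
  where "Know a \<phi> \<equiv> \<^bold>\<not> Bel a (\<^bold>\<not> \<phi>) \<^bold>\<top>"

abbreviation Poss :: "'a \<Rightarrow> ('p, 'a) fm \<Rightarrow> ('p, 'a) fm"
  where "Poss a \<phi> \<equiv> \<^bold>\<not> Know a (\<^bold>\<not> \<phi>)"

text \<open>The worlds form an explicit carrier set. Values of \<open>nbh\<close> at arguments outside the carrier
  are irrelevant junk: nothing below constrains or consults them.\<close>

record ('p, 'a, 'w) model =
  worlds :: "'w set"
  nbh :: "'a \<Rightarrow> 'w \<Rightarrow> 'w set \<Rightarrow> 'w set set"
  val :: "'p \<Rightarrow> 'w set"

definition sim :: "('p, 'a, 'w) model \<Rightarrow> 'a \<Rightarrow> 'w \<Rightarrow> 'w \<Rightarrow> bool" where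
  "sim M a w v \<longleftrightarrow> w \<in> worlds M \<and> v \<in> worlds M \<and> (\<forall>X \<subseteq> worlds M. nbh M a w X = nbh M a v X)"

definition cls :: "('p, 'a, 'w) model \<Rightarrow> 'a \<Rightarrow> 'w \<Rightarrow> 'w set" where
  "cls M a w = {v. sim M a w v}"

definition cn_model :: "('p, 'a, 'w) model \<Rightarrow> bool" where
  "cn_model M \<longleftrightarrow>
     worlds M \<noteq> {} \<and>
     (\<forall>p. val M p \<subseteq> worlds M) \<and>
     \<comment> \<open>(c)\<close>
     (\<forall>a. \<forall>w \<in> worlds M. \<forall>X \<subseteq> worlds M. \<forall>Y \<in> nbh M a w X. Y \<subseteq> X \<inter> cls M a w) \<and>
     \<comment> \<open>(ec)\<close>
     (\<forall>a. \<forall>w \<in> worlds M. \<forall>X \<subseteq> worlds M. \<forall>Y \<subseteq> worlds M.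
        X \<inter> cls M a w = Y \<inter> cls M a w \<longrightarrow> nbh M a w X = nbh M a w Y) \<and>
     \<comment> \<open>(d)\<close>
     (\<forall>a. \<forall>w \<in> worlds M. \<forall>X \<subseteq> worlds M. \<forall>Y \<in> nbh M a w X.
        (X \<inter> cls M a w) - Y \<notin> nbh M a w X) \<and>
     \<comment> \<open>(sc)\<close>
     (\<forall>a. \<forall>w \<in> worlds M. \<forall>X \<subseteq> worlds M. \<forall>Y \<subseteq> X \<inter> cls M a w. \<forall>Z \<subseteq> X \<inter> cls M a w.
        (X \<inter> cls M a w) - Y \<notin> nbh M a w X \<and> Y \<subset> Z \<longrightarrow> Z \<in> nbh M a w X)"

text \<open>The update depends on the updating formula only through its truth set \<open>S\<close>, so it can be
  defined ahead of the semantics.\<close>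

definition sim_upd :: "('p, 'a, 'w) model \<Rightarrow> 'w set \<Rightarrow> 'a \<Rightarrow> 'w \<Rightarrow> 'w \<Rightarrow> bool" where
  "sim_upd M S a w v \<longleftrightarrow> sim M a w v \<and> (w \<in> S \<longleftrightarrow> v \<in> S)"

definition cls_upd :: "('p, 'a, 'w) model \<Rightarrow> 'w set \<Rightarrow> 'a \<Rightarrow> 'w \<Rightarrow> 'w set" where
  "cls_upd M S a w = {v. sim_upd M S a w v}"

definition update :: "('p, 'a, 'w) model \<Rightarrow> 'w set \<Rightarrow> ('p, 'a, 'w) model" where
  "update M S = M\<lparr>nbh := \<lambda>a w X. nbh M a w (X \<inter> cls_upd M S a w)\<rparr>"

fun sat :: "('p, 'a, 'w) model \<Rightarrow> 'w \<Rightarrow> ('p, 'a) fm \<Rightarrow> bool"  ("_, _ \<Turnstile> _" [51, 51, 51] 50) where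
  "M, w \<Turnstile> \<^bold>\<top> \<longleftrightarrow> True"
| "M, w \<Turnstile> Pro p \<longleftrightarrow> w \<in> val M p"
| "M, w \<Turnstile> \<^bold>\<not> \<phi> \<longleftrightarrow> \<not> (M, w \<Turnstile> \<phi>)"
| "M, w \<Turnstile> (\<phi> \<^bold>\<and> \<psi>) \<longleftrightarrow> (M, w \<Turnstile> \<phi>) \<and> (M, w \<Turnstile> \<psi>)"
| "M, w \<Turnstile> Bel a \<phi> \<psi> \<longleftrightarrow>
     (\<exists>Y \<in> nbh M a w {v \<in> worlds M. M, v \<Turnstile> \<phi>}. Y \<subseteq> {v \<in> worlds M. M, v \<Turnstile> \<psi>})"
| "M, w \<Turnstile> [\<plusminus> \<phi>] \<psi> \<longleftrightarrow> (update M {v \<in> worlds M. M, v \<Turnstile> \<phi>}, w \<Turnstile> \<psi>)"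

text \<open>Propositional tautologies: formulas not built by a Boolean connective are treated as
  atoms.\<close>

fun bool_eval :: "(('p, 'a) fm \<Rightarrow> bool) \<Rightarrow> ('p, 'a) fm \<Rightarrow> bool" where
  "bool_eval h \<^bold>\<top> \<longleftrightarrow> True"
| "bool_eval h (\<^bold>\<not> \<phi>) \<longleftrightarrow> \<not> bool_eval h \<phi>"
| "bool_eval h (\<phi> \<^bold>\<and> \<psi>) \<longleftrightarrow> bool_eval h \<phi> \<and> bool_eval h \<psi>"
| "bool_eval h (Pro p) \<longleftrightarrow> h (Pro p)"
| "bool_eval h (Bel a \<phi> \<psi>) \<longleftrightarrow> h (Bel a \<phi> \<psi>)"
| "bool_eval h ([\<plusminus> \<phi>] \<psi>) \<longleftrightarrow> h ([\<plusminus> \<phi>] \<psi>)"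

definition tautology :: "('p, 'a) fm \<Rightarrow> bool" where
  "tautology \<phi> \<longleftrightarrow> (\<forall>h. bool_eval h \<phi>)"

inductive PC :: "('p, 'a) fm \<Rightarrow> bool"  ("\<turnstile> _" [50] 50) where
  Taut: "tautology \<phi> \<Longrightarrow> \<turnstile> \<phi>"
| DistK: "\<turnstile> Know a (\<phi> \<^bold>\<longrightarrow> \<psi>) \<^bold>\<longrightarrow> Know a \<phi> \<^bold>\<longrightarrow> Know a \<psi>"
| T: "\<turnstile> Know a \<phi> \<^bold>\<longrightarrow> \<phi>"
| B5: "\<turnstile> Bel a \<phi> \<psi> \<^bold>\<longrightarrow> Know a (Bel a \<phi> \<psi>)"
| B4: "\<turnstile> \<^bold>\<not> Bel a \<phi> \<psi> \<^bold>\<longrightarrow> Know a (\<^bold>\<not> Bel a \<phi> \<psi>)"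
| D: "\<turnstile> Bel a \<phi> \<psi> \<^bold>\<longrightarrow> \<^bold>\<not> Bel a \<phi> (\<^bold>\<not> \<psi>)"
| EC: "\<turnstile> Know a (\<phi> \<^bold>\<longleftrightarrow> \<psi>) \<^bold>\<longrightarrow> Bel a \<phi> \<chi> \<^bold>\<longrightarrow> Bel a \<psi> \<chi>"
| M: "\<turnstile> Know a (\<phi> \<^bold>\<longrightarrow> \<psi>) \<^bold>\<longrightarrow> Bel a \<chi> \<phi> \<^bold>\<longrightarrow> Bel a \<chi> \<psi>"
| C: "\<turnstile> Bel a \<phi> \<psi> \<^bold>\<longrightarrow> Bel a \<phi> (\<phi> \<^bold>\<and> \<psi>)"
| SC: "\<turnstile> \<^bold>\<not> Bel a \<chi> (\<^bold>\<not> \<phi>) \<^bold>\<and> Poss a (\<chi> \<^bold>\<and> \<^bold>\<not> \<phi> \<^bold>\<and> \<psi>) \<^bold>\<longrightarrow> Bel a \<chi> (\<phi> \<^bold>\<or> \<psi>)"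
| MP: "\<turnstile> \<phi> \<^bold>\<longrightarrow> \<psi> \<Longrightarrow> \<turnstile> \<phi> \<Longrightarrow> \<turnstile> \<psi>"
| NecK: "\<turnstile> \<phi> \<Longrightarrow> \<turnstile> Know a \<phi>"
| RedPro: "\<turnstile> [\<plusminus> \<phi>] Pro p \<^bold>\<longleftrightarrow> Pro p"
| RedNeg: "\<turnstile> [\<plusminus> \<phi>] \<^bold>\<not> \<psi> \<^bold>\<longleftrightarrow> \<^bold>\<not> [\<plusminus> \<phi>] \<psi>"
| RedCon: "\<turnstile> [\<plusminus> \<phi>] (\<psi> \<^bold>\<and> \<chi>) \<^bold>\<longleftrightarrow> [\<plusminus> \<phi>] \<psi> \<^bold>\<and> [\<plusminus> \<phi>] \<chi>"
| RedBel: "\<turnstile> [\<plusminus> \<phi>] (Bel a \<psi> \<chi>) \<^bold>\<longleftrightarrow>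
     (\<phi> \<^bold>\<longrightarrow> Bel a (\<phi> \<^bold>\<and> [\<plusminus> \<phi>] \<psi>) ([\<plusminus> \<phi>] \<chi>)) \<^bold>\<and>
     (\<^bold>\<not> \<phi> \<^bold>\<longrightarrow> Bel a (\<^bold>\<not> \<phi> \<^bold>\<and> [\<plusminus> \<phi>] \<psi>) ([\<plusminus> \<phi>] \<chi>))"

end

theory Submission
  imports Defs
begin

text \<open>No rule of the calculus puts a derived formula below an update, so truth at all worlds
  of one fixed model is already inductive, and it is not needed that updates preserve the
  class of conditional neighbourhood models. For the belief axioms, (c), (d) and (sc) make each
  \<open>nbh M a w X\<close> an upward closed family of subsets of \<open>X \<inter> cls M a w\<close> which is empty exactly
  when \<open>X \<inter> cls M a w\<close> is; hence \<open>Know a\<close> is the universal modality on \<open>cls M a w\<close>. The reduction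
  axiom for belief follows by (ec), since the updated class is \<open>cls M a w\<close> cut down to the truth
  set of the updating formula or of its negation.\<close>

section \<open>Classes and the conditions on models\<close>

abbreviation ext :: "('p, 'a, 'w) model \<Rightarrow> ('p, 'a) fm \<Rightarrow> 'w set" where
  "ext M \<phi> \<equiv> {v \<in> worlds M. M, v \<Turnstile> \<phi>}"

lemma mem_cls_self: "w \<in> worlds M \<Longrightarrow> w \<in> cls M a w"
  by (simp add: cls_def sim_def)

lemma cls_subset_worlds: "cls M a w \<subseteq> worlds M"
  by (auto simp: cls_def sim_def)

lemma nbh_eq_if_mem_cls: "v \<in> cls M a w \<Longrightarrow> X \<subseteq> worlds M \<Longrightarrow> nbh M a v X = nbh M a w X"
  by (simp add: cls_def sim_def)

lemma cn_model_c:
  assumes "cn_model M" "w \<in> worlds M" "X \<subseteq> worlds M" "Y \<in> nbh M a w X"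
  shows "Y \<subseteq> X \<inter> cls M a w"
proof -
  have "\<forall>a. \<forall>w \<in> worlds M. \<forall>X \<subseteq> worlds M. \<forall>Y \<in> nbh M a w X. Y \<subseteq> X \<inter> cls M a w"
    using assms(1) unfolding cn_model_def by (elim conjE)
  with assms(2-4) show ?thesis by simp
qed

lemma cn_model_ec:
  assumes "cn_model M" "w \<in> worlds M" "X \<subseteq> worlds M" "Y \<subseteq> worlds M"
    and "X \<inter> cls M a w = Y \<inter> cls M a w"
  shows "nbh M a w X = nbh M a w Y"
proof -
  have "\<forall>a. \<forall>w \<in> worlds M. \<forall>X \<subseteq> worlds M. \<forall>Y \<subseteq> worlds M.
      X \<inter> cls M a w = Y \<inter> cls M a w \<longrightarrow> nbh M a w X = nbh M a w Y"
    using assms(1) unfolding cn_model_def by (elim conjE)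
  from this[rule_format, OF assms(2-5)] show ?thesis .
qed

lemma cn_model_d:
  assumes "cn_model M" "w \<in> worlds M" "X \<subseteq> worlds M" "Y \<in> nbh M a w X"
  shows "(X \<inter> cls M a w) - Y \<notin> nbh M a w X"
proof -
  have "\<forall>a. \<forall>w \<in> worlds M. \<forall>X \<subseteq> worlds M. \<forall>Y \<in> nbh M a w X.
      (X \<inter> cls M a w) - Y \<notin> nbh M a w X"
    using assms(1) unfolding cn_model_def by (elim conjE)
  with assms(2-4) show ?thesis by simp
qed

lemma cn_model_sc:
  assumes "cn_model M" "w \<in> worlds M" "X \<subseteq> worlds M" "Z \<subseteq> X \<inter> cls M a w"
    and "(X \<inter> cls M a w) - Y \<notin> nbh M a w X" "Y \<subset> Z"
  shows "Z \<in> nbh M a w X"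
proof -
  have "\<forall>a. \<forall>w \<in> worlds M. \<forall>X \<subseteq> worlds M. \<forall>Y \<subseteq> X \<inter> cls M a w. \<forall>Z \<subseteq> X \<inter> cls M a w.
      (X \<inter> cls M a w) - Y \<notin> nbh M a w X \<and> Y \<subset> Z \<longrightarrow> Z \<in> nbh M a w X"
    using assms(1) unfolding cn_model_def by (elim conjE)
  moreover have "Y \<subseteq> X \<inter> cls M a w"
    using assms(4,6) by blast
  ultimately show ?thesis
    using assms(2-6) by simp
qed

section \<open>Structure of the neighbourhood families\<close>

lemma nbh_upward_closed:
  assumes "cn_model M" "w \<in> worlds M" "X \<subseteq> worlds M" "Y \<in> nbh M a w X"
    and "Y \<subseteq> Z" "Z \<subseteq> X \<inter> cls M a w"
  shows "Z \<in> nbh M a w X"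
  \<comment> \<open>(d) supplies the premise of (sc) that the complement of \<open>Y\<close> is no
    neighbourhood; (sc) itself covers only proper supersets.\<close>
  using cn_model_sc[OF assms(1-3) assms(6) cn_model_d[OF assms(1-4)]] assms(4,5)
  by (cases "Y = Z") auto

text \<open>If \<open>Y\<close> and \<open>Z\<close> were disjoint, \<open>Z\<close> would lie in
  the complement of \<open>Y\<close>, which would then be a neighbourhood by upward closure, against
  (d).\<close>

lemma nbh_inter_nonempty:
  assumes "cn_model M" "w \<in> worlds M" "X \<subseteq> worlds M"
    and "Y \<in> nbh M a w X" "Z \<in> nbh M a w X"
  shows "Y \<inter> Z \<noteq> {}"
proof
  assume "Y \<inter> Z = {}"
  then have "Z \<subseteq> (X \<inter> cls M a w) - Y"
    using cn_model_c[OF assms(1-3) assms(5)] by blast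
  then have "(X \<inter> cls M a w) - Y \<in> nbh M a w X"
    by (intro nbh_upward_closed[OF assms(1-3) assms(5)]) auto
  with cn_model_d[OF assms(1-4)] show False ..
qed

lemma nbh_eq_empty_iff:
  assumes "cn_model M" "w \<in> worlds M" "X \<subseteq> worlds M"
  shows "nbh M a w X = {} \<longleftrightarrow> X \<inter> cls M a w = {}"
proof
  assume empty: "nbh M a w X = {}"
  show "X \<inter> cls M a w = {}"
  proof (rule ccontr)
    assume "X \<inter> cls M a w \<noteq> {}"
    \<comment> \<open>(sc) is applied from \<open>{}\<close>: its complement is not a neighbourhood,
      as there are none, so every nonempty subset becomes one.\<close>
    then have "X \<inter> cls M a w \<in> nbh M a w X"
      using empty by (intro cn_model_sc[OF assms, of _ _ "{}"]) auto
    with empty show False by simp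
  qed
next
  assume "X \<inter> cls M a w = {}"
  \<comment> \<open>By (c) the only candidate is \<open>{}\<close>, which cannot meet
    itself.\<close>
  then show "nbh M a w X = {}"
    using cn_model_c[OF assms] nbh_inter_nonempty[OF assms] by blast
qed

section \<open>Truth of knowledge and belief formulas\<close>

lemma sat_Know_iff:
  assumes "cn_model M" "w \<in> worlds M"
  shows "M, w \<Turnstile> Know a \<phi> \<longleftrightarrow> (\<forall>v \<in> cls M a w. M, v \<Turnstile> \<phi>)"
proof -
  let ?X = "ext M (\<^bold>\<not> \<phi>)"
  have X: "?X \<subseteq> worlds M" by blast
  have "M, w \<Turnstile> Know a \<phi> \<longleftrightarrow> (\<forall>Y \<in> nbh M a w ?X. \<not> Y \<subseteq> worlds M)"
    by simp
  \<comment> \<open>By (c) every neighbourhood consists of worlds, so knowledge says that there is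
    none.\<close>
  also have "\<dots> \<longleftrightarrow> nbh M a w ?X = {}"
    using cn_model_c[OF assms X] by blast
  also have "\<dots> \<longleftrightarrow> ?X \<inter> cls M a w = {}"
    by (rule nbh_eq_empty_iff[OF assms X])
  also have "\<dots> \<longleftrightarrow> (\<forall>v \<in> cls M a w. M, v \<Turnstile> \<phi>)"
    using cls_subset_worlds[of M a w] by auto
  finally show ?thesis .
qed

text \<open>Peels off an implication while leaving \<open>Know a\<close>, itself a negation, in the
  form that \<open>sat_Know_iff\<close> rewrites.\<close>

lemma sat_Imp_iff: "M, w \<Turnstile> (\<phi> \<^bold>\<longrightarrow> \<psi>) \<longleftrightarrow> (M, w \<Turnstile> \<phi> \<longrightarrow> M, w \<Turnstile> \<psi>)"
  by simp

lemma sat_Bel_if_mem_cls: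
  "v \<in> cls M a w \<Longrightarrow> M, v \<Turnstile> Bel a \<phi> \<psi> \<longleftrightarrow> M, w \<Turnstile> Bel a \<phi> \<psi>"
  by (simp add: nbh_eq_if_mem_cls)

text \<open>Truth at \<open>w\<close> serves as the valuation of the Boolean atoms, which is how
  tautologies become true.\<close>

lemma bool_eval_sat: "bool_eval (sat M w) \<phi> \<longleftrightarrow> M, w \<Turnstile> \<phi>"
  by (induction \<phi>) auto

lemma tautology_sat: "tautology \<phi> \<Longrightarrow> M, w \<Turnstile> \<phi>"
  using bool_eval_sat[of M w \<phi>] by (simp add: tautology_def)

lemma sat_Bel_cong:
  assumes "cn_model M" "w \<in> worlds M"
    and "\<And>v. v \<in> cls M a w \<Longrightarrow> M, v \<Turnstile> \<phi> \<longleftrightarrow> M, v \<Turnstile> \<psi>"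
  shows "M, w \<Turnstile> Bel a \<phi> \<chi> \<longleftrightarrow> M, w \<Turnstile> Bel a \<psi> \<chi>"
proof -
  have "nbh M a w (ext M \<phi>) = nbh M a w (ext M \<psi>)"
    using assms(3) by (intro cn_model_ec[OF assms(1,2)]) auto
  then show ?thesis by simp
qed

text \<open>(c) confines the witnessing neighbourhood to the \<chi>-worlds of the class. Assuming
  \<chi> in the implication lets the lemma serve both \<open>M\<close> and \<open>C\<close>.\<close>

lemma sat_Bel_mono:
  assumes "cn_model M" "w \<in> worlds M" "M, w \<Turnstile> Bel a \<chi> \<phi>"
    and "\<And>v. v \<in> cls M a w \<Longrightarrow> M, v \<Turnstile> \<chi> \<Longrightarrow> M, v \<Turnstile> \<phi> \<Longrightarrow> M, v \<Turnstile> \<psi>"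
  shows "M, w \<Turnstile> Bel a \<chi> \<psi>"
proof -
  obtain Y where Y: "Y \<in> nbh M a w (ext M \<chi>)" "Y \<subseteq> ext M \<phi>"
    using assms(3) by auto
  have "Y \<subseteq> ext M \<chi> \<inter> cls M a w"
    using Y(1) by (intro cn_model_c[OF assms(1,2)]) auto
  then have "Y \<subseteq> ext M \<psi>"
    using Y(2) assms(4) by blast
  with Y(1) show ?thesis by auto
qed

text \<open>Witnesses of opposite beliefs would be neighbourhoods of the same set and hence share a
  world.\<close>

lemma sat_Bel_consistent:
  assumes "cn_model M" "w \<in> worlds M" "M, w \<Turnstile> Bel a \<phi> \<psi>"
  shows "\<not> M, w \<Turnstile> Bel a \<phi> (\<^bold>\<not> \<psi>)"
proof
  assume "M, w \<Turnstile> Bel a \<phi> (\<^bold>\<not> \<psi>)"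
  then obtain Z where Z: "Z \<in> nbh M a w (ext M \<phi>)" "Z \<subseteq> ext M (\<^bold>\<not> \<psi>)"
    by auto
  obtain Y where Y: "Y \<in> nbh M a w (ext M \<phi>)" "Y \<subseteq> ext M \<psi>"
    using assms(3) by auto
  have "Y \<inter> Z \<noteq> {}"
    by (rule nbh_inter_nonempty[OF assms(1,2) _ Y(1) Z(1)]) auto
  with Y(2) Z(2) show False by auto
qed

text \<open>Among the \<chi>-worlds of the class, the complement of the \<phi>-worlds is no
  neighbourhood, since it would witness the excluded belief. Then (sc) applies to the larger set of
  worlds with \<phi> or \<psi>; \<open>v\<close> makes the inclusion strict.\<close>

lemma sat_Bel_strong_commitment:
  assumes "cn_model M" "w \<in> worlds M"
    and "\<not> M, w \<Turnstile> Bel a \<chi> (\<^bold>\<not> \<phi>)"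
    and "v \<in> cls M a w" "M, v \<Turnstile> \<chi>" "\<not> M, v \<Turnstile> \<phi>" "M, v \<Turnstile> \<psi>"
  shows "M, w \<Turnstile> Bel a \<chi> (\<phi> \<^bold>\<or> \<psi>)"
proof -
  let ?X = "ext M \<chi> \<inter> cls M a w"
  let ?Y = "?X \<inter> ext M \<phi>" and ?Z = "?X \<inter> ext M (\<phi> \<^bold>\<or> \<psi>)"
  have "?X - ?Y \<subseteq> ext M (\<^bold>\<not> \<phi>)" by auto
  then have "?X - ?Y \<notin> nbh M a w (ext M \<chi>)"
    using assms(3) by auto
  moreover have "?Y \<subset> ?Z"
  proof
    show "?Y \<subseteq> ?Z" by auto
    have "v \<in> ?Z" "v \<notin> ?Y"
      using assms(4-7) cls_subset_worlds[of M a w] by auto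
    then show "?Y \<noteq> ?Z" by blast
  qed
  ultimately have "?Z \<in> nbh M a w (ext M \<chi>)"
    by (intro cn_model_sc[OF assms(1,2), of _ _ _ ?Y]) auto
  then show ?thesis
    by (auto intro!: bexI[of _ ?Z])
qed

section \<open>Updates and the reduction of belief\<close>

lemma cls_upd_eq:
  "w \<in> S \<Longrightarrow> cls_upd M S a w = cls M a w \<inter> S"
  "w \<notin> S \<Longrightarrow> cls_upd M S a w = cls M a w - S"
  by (auto simp: cls_upd_def sim_upd_def cls_def)

lemma worlds_update [simp]: "worlds (update M S) = worlds M"
  by (simp add: update_def)

lemma val_update [simp]: "val (update M S) = val M"
  by (simp add: update_def)

lemma nbh_update: "nbh (update M S) a w X = nbh M a w (X \<inter> cls_upd M S a w)"
  by (simp add: update_def)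

text \<open>Inside the class of \<open>w\<close>, cutting down to the updated class amounts to
  adding the conjunct \<phi>, so (ec) identifies the two families.\<close>

lemma sat_Upd_Bel_pos:
  assumes "cn_model M" "w \<in> worlds M" "M, w \<Turnstile> \<phi>"
  shows "M, w \<Turnstile> [\<plusminus> \<phi>] (Bel a \<psi> \<chi>) \<longleftrightarrow>
    M, w \<Turnstile> Bel a (\<phi> \<^bold>\<and> [\<plusminus> \<phi>] \<psi>) ([\<plusminus> \<phi>] \<chi>)"
proof -
  have "cls_upd M (ext M \<phi>) a w = cls M a w \<inter> ext M \<phi>"
    using assms(2,3) by (intro cls_upd_eq) auto
  then have "nbh M a w (ext M ([\<plusminus> \<phi>] \<psi>) \<inter> cls_upd M (ext M \<phi>) a w) =
      nbh M a w (ext M (\<phi> \<^bold>\<and> [\<plusminus> \<phi>] \<psi>))"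
    by (intro cn_model_ec[OF assms(1,2)]) auto
  then show ?thesis by (simp add: nbh_update)
qed

text \<open>Here the updated class keeps the worlds where \<phi> fails, hence the negated
  conjunct.\<close>

lemma sat_Upd_Bel_neg:
  assumes "cn_model M" "w \<in> worlds M" "\<not> M, w \<Turnstile> \<phi>"
  shows "M, w \<Turnstile> [\<plusminus> \<phi>] (Bel a \<psi> \<chi>) \<longleftrightarrow>
    M, w \<Turnstile> Bel a (\<^bold>\<not> \<phi> \<^bold>\<and> [\<plusminus> \<phi>] \<psi>) ([\<plusminus> \<phi>] \<chi>)"
proof -
  have "cls_upd M (ext M \<phi>) a w = cls M a w - ext M \<phi>"
    using assms(3) by (intro cls_upd_eq) auto
  then have "nbh M a w (ext M ([\<plusminus> \<phi>] \<psi>) \<inter> cls_upd M (ext M \<phi>) a w) =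
      nbh M a w (ext M (\<^bold>\<not> \<phi> \<^bold>\<and> [\<plusminus> \<phi>] \<psi>))"
    by (intro cn_model_ec[OF assms(1,2)]) auto
  then show ?thesis by (simp add: nbh_update)
qed

theorem theorem8:
  fixes \<phi> :: "('p, 'a::finite) fm"
    and M :: "('p, 'a, 'w) model"
  assumes "\<turnstile> \<phi>"
    and "cn_model M"
    and "w \<in> worlds M"
  shows "M, w \<Turnstile> \<phi>"
  using assms(1,3)
\<comment> \<open>\<open>w\<close> is generalised because \<open>NecK\<close> needs its hypothesis
  at every world of the class.\<close>
proof (induction arbitrary: w rule: PC.induct)
  case (Taut \<phi>)
  then show ?case by (simp add: tautology_sat)
next
  case (DistK a \<phi> \<psi>)
  note Know = sat_Know_iff[OF assms(2) DistK]
  show ?case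
    unfolding sat_Imp_iff Know by blast
next
  case (T a \<phi>)
  show ?case
    unfolding sat_Imp_iff sat_Know_iff[OF assms(2) T] using mem_cls_self[OF T] by blast
next
  case (B5 a \<phi> \<psi>)
  show ?case
    unfolding sat_Imp_iff sat_Know_iff[OF assms(2) B5]
    using sat_Bel_if_mem_cls[of _ M a w \<phi> \<psi>] by blast
next
  case (B4 a \<phi> \<psi>)
  show ?case
    unfolding sat_Imp_iff sat_Know_iff[OF assms(2) B4] sat.simps(3)[of _ _ "Bel a \<phi> \<psi>"]
    using sat_Bel_if_mem_cls[of _ M a w \<phi> \<psi>] by blast
next
  case (D a \<phi> \<psi>)
  show ?case
    unfolding sat_Imp_iff sat.simps(3)[of _ _ "Bel _ _ _"]
    using sat_Bel_consistent[OF assms(2) D, of a \<phi> \<psi>] by blast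
next
  case (EC a \<phi> \<psi> \<chi>)
  show ?case
    unfolding sat_Imp_iff sat_Know_iff[OF assms(2) EC] sat.simps(4)
    using sat_Bel_cong[OF assms(2) EC, of a \<phi> \<psi> \<chi>] by blast
next
  case (M a \<phi> \<psi> \<chi>)
  show ?case
    unfolding sat_Imp_iff sat_Know_iff[OF assms(2) M]
    using sat_Bel_mono[OF assms(2) M, of a \<chi> \<phi> \<psi>] by blast
next
  case (C a \<phi> \<psi>)
  show ?case
    unfolding sat_Imp_iff
    \<comment> \<open>Worlds of the witnessing neighbourhood already satisfy the condition
      \<phi>.\<close>
    using sat_Bel_mono[OF assms(2) C, of a \<phi> \<psi> "\<phi> \<^bold>\<and> \<psi>"] by simp
next
  case (SC a \<chi> \<phi> \<psi>)
  show ?case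
    unfolding sat_Imp_iff
  proof
    assume "M, w \<Turnstile> (\<^bold>\<not> Bel a \<chi> (\<^bold>\<not> \<phi>) \<^bold>\<and> Poss a (\<chi> \<^bold>\<and> \<^bold>\<not> \<phi> \<^bold>\<and> \<psi>))"
    then have not_bel: "\<not> M, w \<Turnstile> Bel a \<chi> (\<^bold>\<not> \<phi>)"
      and "\<not> M, w \<Turnstile> Know a (\<^bold>\<not> (\<chi> \<^bold>\<and> \<^bold>\<not> \<phi> \<^bold>\<and> \<psi>))"
      by auto
    then obtain v where "v \<in> cls M a w" "M, v \<Turnstile> (\<chi> \<^bold>\<and> \<^bold>\<not> \<phi> \<^bold>\<and> \<psi>)"
      unfolding sat_Know_iff[OF assms(2) SC] by auto
    with not_bel show "M, w \<Turnstile> Bel a \<chi> (\<phi> \<^bold>\<or> \<psi>)"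
      by (intro sat_Bel_strong_commitment[OF assms(2) SC]) auto
  qed
next
  case (MP \<phi> \<psi>)
  then show ?case by simp
next
  case (NecK \<phi> a)
  then show ?case
    unfolding sat_Know_iff[OF assms(2) NecK.prems] using cls_subset_worlds[of M a w] by blast
next
  case (RedPro \<phi> p)
  show ?case by simp
next
  case (RedNeg \<phi> \<psi>)
  show ?case by simp
next
  case (RedCon \<phi> \<psi> \<chi>)
  show ?case by simp
next
  case (RedBel \<phi> a \<psi> \<chi>)
  show ?case
    \<comment> \<open>The truth value of \<phi> at \<open>w\<close> selects one of the two
      conjuncts; the other is vacuous.\<close>
    using sat_Upd_Bel_pos[OF assms(2) RedBel, of \<phi> a \<psi> \<chi>]
      sat_Upd_Bel_neg[OF assms(2) RedBel, of \<phi> a \<psi> \<chi>]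
    unfolding sat_Imp_iff sat.simps(4)[of _ _ "_ \<^bold>\<longrightarrow> _"] sat.simps(3)[of _ _ \<phi>] by blast
qed

end
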